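(* Let $X$ be a compactum and let $\ast$ be a continuous t-norm. A functional $I:C(X,[0,1])\to[0,1]$ satisfies the three properties (1) $I(1_X)=1$; (2) $I(\varphi\vee\psi)=I(\varphi)\vee I(\psi)$ for all comonotone functions $\varphi,\psi\in C(X,[0,1])$; (3) $I(c_X\ast\varphi)=c\ast I(\varphi)$ for each $c\in[0,1]$ and $\varphi\in C(X,[0,1])$ if and only if there exists a unique capacity $\nu$ on $X$ such that $I$ is the t-normed integral with respect to $\nu$, that is, $$I(f)=\int_X^{\vee\ast}f\,d\nu=\max\{\nu(f^{-1}([t,1]))\ast t\mid t\in[0,1]\}\quad\text{for all } f\in C(X,[0,1]).$$
   Context: A compactum is a compact Hausdorff space. $C(X,[0,1])$ is the set of continuous functions $X\to[0,1]$; $\vee$ denotes (pointwise) maximum. For $c\in[0,1]$, $c_X$ is the constant function on $X$ with value $c$. A t-norm (triangular norm) is a binary operation $\ast$ on $[0,1]$ that is associative, commutative, monotone (nondecreasing in each argument) and satisfies $s\ast 1=s$ for each $s\in[0,1]$; it is applied to functions pointwise. Two functions $\varphi,\psi\in C(X,[0,1])$ are comonotone if $(\varphi(x_1)-\varphi(x_2))\cdot(\psi(x_1)-\psi(x_2))\ge0$ for all $x_1,x_2\in X$. A functional is an arbitrary map $C(X,[0,1])\to[0,1]$. Let $\mathcal F(X)$ be the family of all closed subsets of $X$ (including $\emptyset$). A capacity (upper-semicontinuous capacity) on $X$ is a function $\nu:\mathcal F(X)\to[0,1]$ such that for all closed $F,G\subset X$: (1) $\nu(X)=1$, $\nu(\emptyset)=0$;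 (2) $F\subset G$ implies $\nu(F)\le\nu(G)$; (3) if $\nu(F)<a$ for some $a\in[0,1]$, then there exists an open set $O\supset F$ such that $\nu(B)<a$ for each compact set $B\subset O$. *)

theory Defs
  imports "HOL-Analysis.Analysis"
begin

text \<open>
  A compactum is an abstract topology \<open>X\<close> with \<open>compact_space X\<close> and \<open>Hausdorff_space X\<close>.
  Functions on \<open>topspace X\<close> and on the closed subsets of \<open>X\<close> are taken extensional
  (\<open>undefined\<close> outside their domain), so that equality and uniqueness mean what they mean for
  functions with that domain.
\<close>

definition cont01 :: "'a topology \<Rightarrow> ('a \<Rightarrow> real) set" where
  "cont01 X = {f \<in> topspace X \<rightarrow>\<^sub>E {0..1}. continuous_map X euclideanreal f}"

definition const_on :: "'a topology \<Rightarrow> real \<Rightarrow> 'a \<Rightarrow> real" where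
  "const_on X c = (\<lambda>x\<in>topspace X. c)"

definition pointwise ::
    "'a topology \<Rightarrow> (real \<Rightarrow> real \<Rightarrow> real) \<Rightarrow> ('a \<Rightarrow> real) \<Rightarrow> ('a \<Rightarrow> real) \<Rightarrow> 'a \<Rightarrow> real" where
  "pointwise X b \<phi> \<psi> = (\<lambda>x\<in>topspace X. b (\<phi> x) (\<psi> x))"

definition comonotone :: "'a topology \<Rightarrow> ('a \<Rightarrow> real) \<Rightarrow> ('a \<Rightarrow> real) \<Rightarrow> bool" where
  "comonotone X \<phi> \<psi> \<longleftrightarrow>
     (\<forall>x\<in>topspace X. \<forall>y\<in>topspace X. (\<phi> x - \<phi> y) * (\<psi> x - \<psi> y) \<ge> 0)"

text \<open>Only the values of \<open>T\<close> on the unit square matter.\<close>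

definition t_norm :: "(real \<Rightarrow> real \<Rightarrow> real) \<Rightarrow> bool" where
  "t_norm T \<longleftrightarrow>
     (\<forall>s\<in>{0..1}. \<forall>t\<in>{0..1}. T s t \<in> {0..1}) \<and>
     (\<forall>r\<in>{0..1}. \<forall>s\<in>{0..1}. \<forall>t\<in>{0..1}. T (T r s) t = T r (T s t)) \<and>
     (\<forall>s\<in>{0..1}. \<forall>t\<in>{0..1}. T s t = T t s) \<and>
     (\<forall>r\<in>{0..1}. \<forall>s\<in>{0..1}. \<forall>t\<in>{0..1}. s \<le> t \<longrightarrow> T s r \<le> T t r \<and> T r s \<le> T r t) \<and>
     (\<forall>s\<in>{0..1}. T s 1 = s)"

definition continuous_t_norm :: "(real \<Rightarrow> real \<Rightarrow> real) \<Rightarrow> bool" where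
  "continuous_t_norm T \<longleftrightarrow> t_norm T \<and> continuous_on ({0..1} \<times> {0..1}) (\<lambda>(s, t). T s t)"

definition capacity :: "'a topology \<Rightarrow> ('a set \<Rightarrow> real) \<Rightarrow> bool" where
  "capacity X \<nu> \<longleftrightarrow>
     \<nu> \<in> {F. closedin X F} \<rightarrow>\<^sub>E {0..1} \<and>
     \<nu> (topspace X) = 1 \<and> \<nu> {} = 0 \<and>
     (\<forall>F G. closedin X F \<longrightarrow> closedin X G \<longrightarrow> F \<subseteq> G \<longrightarrow> \<nu> F \<le> \<nu> G) \<and>
     (\<forall>F. \<forall>a\<in>{0..1}. closedin X F \<longrightarrow> \<nu> F < a \<longrightarrow>
        (\<exists>W. openin X W \<and> F \<subseteq> W \<and> (\<forall>B. compactin X B \<longrightarrow> B \<subseteq> W \<longrightarrow> \<nu> B < a)))"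

definition t_values ::
    "'a topology \<Rightarrow> (real \<Rightarrow> real \<Rightarrow> real) \<Rightarrow> ('a set \<Rightarrow> real) \<Rightarrow> ('a \<Rightarrow> real) \<Rightarrow> real set" where
  "t_values X T \<nu> f = {T (\<nu> {x \<in> topspace X. f x \<in> {t..1}}) t |t. t \<in> {0..1}}"

text \<open>
  \<open>Max\<close> is only meaningful for finite sets, so the maximum is the greatest element in the sense
  of \<open>Greatest\<close>; lemma \<open>t_integral_is_max\<close> below shows that it exists.
\<close>

definition t_integral ::
    "'a topology \<Rightarrow> (real \<Rightarrow> real \<Rightarrow> real) \<Rightarrow> ('a set \<Rightarrow> real) \<Rightarrow> ('a \<Rightarrow> real) \<Rightarrow> real" where
  "t_integral X T \<nu> f = (GREATEST y. y \<in> t_values X T \<nu> f)"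

lemma closedin_superlevel:
  assumes "f \<in> cont01 X"
  shows "closedin X {x \<in> topspace X. f x \<in> {t..1}}"
  using assms closedin_continuous_map_preimage[of X euclideanreal f "{t..1}"]
  by (auto simp: cont01_def)

lemma capacity_superlevel_usc:
  assumes X: "compact_space X" "Hausdorff_space X" and \<nu>: "capacity X \<nu>" and f: "f \<in> cont01 X"
    and a: "a \<in> {0..1}" "\<nu> {x \<in> topspace X. f x \<in> {t..1}} < a"
  shows "\<exists>m<t. \<forall>r>m. \<nu> {x \<in> topspace X. f x \<in> {r..1}} < a"
proof -
  obtain W where W: "openin X W" "{x \<in> topspace X. f x \<in> {t..1}} \<subseteq> W"
    "\<And>B. compactin X B \<Longrightarrow> B \<subseteq> W \<Longrightarrow> \<nu> B < a"
    using \<nu> a closedin_superlevel[OF f] unfolding capacity_def by meson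
  have fr: "f x \<le> 1" if "x \<in> topspace X" for x using f that by (auto simp: cont01_def)
  define K where "K = topspace X - W"
  have "compactin X K" unfolding K_def using W(1) X(1) by (intro closedin_compact_space closedin_diff) auto
  hence cK: "compact (f ` K)"
    using f image_compactin[of X K euclideanreal f] by (auto simp: cont01_def)
  have Kt: "f x < t" if "x \<in> K" for x using that W(2) fr by (force simp: K_def)
  have "\<exists>m<t. \<forall>x\<in>K. f x \<le> m"
  proof (cases "K = {}")
    case True thus ?thesis using lt_ex by auto
  next
    case False
    then obtain y where "y \<in> f ` K" "\<forall>z\<in>f ` K. z \<le> y"
      using compact_attains_sup[OF cK] by auto
    thus ?thesis using Kt by (intro exI[of _ y]) auto
  qed
  then obtain m where m: "m < t" "\<And>x. x \<in> K \<Longrightarrow> f x \<le> m" by auto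
  have "\<nu> {x \<in> topspace X. f x \<in> {r..1}} < a" if "r > m" for r
  proof (rule W(3))
    show "compactin X {x \<in> topspace X. f x \<in> {r..1}}"
      using closedin_compact_space[OF X(1) closedin_superlevel[OF f]] .
    show "{x \<in> topspace X. f x \<in> {r..1}} \<subseteq> W"
      using m(2) that unfolding K_def by fastforce
  qed
  with m(1) show ?thesis by blast
qed

lemma t_integral_is_max:
  assumes X: "compact_space X" "Hausdorff_space X" and T: "continuous_t_norm T"
    and \<nu>: "capacity X \<nu>" and f: "f \<in> cont01 X"
  shows "t_integral X T \<nu> f \<in> t_values X T \<nu> f"
    and "y \<in> t_values X T \<nu> f \<Longrightarrow> y \<le> t_integral X T \<nu> f"
proof -
  define U where "U t = \<nu> {x \<in> topspace X. f x \<in> {t..1}}" for t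
  define g where "g t = T (U t) t" for t
  have U01: "U t \<in> {0..1}" for t
    using \<nu> closedin_superlevel[OF f, of t] unfolding capacity_def U_def by blast
  have Tm: "T a r \<le> T b r" if "a \<in> {0..1}" "b \<in> {0..1}" "r \<in> {0..1}" "a \<le> b" for a b r
    using T that unfolding continuous_t_norm_def t_norm_def by blast
  have T1: "T 1 r = r" if "r \<in> {0..1}" for r
    using T that unfolding continuous_t_norm_def t_norm_def
    by (metis atLeastAtMost_iff order_refl zero_le_one)
  have Tc: "continuous_on ({0..1} \<times> {0..1}) (\<lambda>(s, t). T s t)"
    using T by (simp add: continuous_t_norm_def)
  have usc: "\<exists>N. open N \<and> t \<in> N \<and> (\<forall>r\<in>N \<inter> {0..1}. g r < y)"
    if t: "t \<in> {0..1}" and y: "g t < y" for t y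
  proof (cases "U t = 1")
    case True
    have "g r < y" if "r < y" "r \<in> {0..1}" for r
      using Tm[of "U r" 1 r] U01[of r] T1[of r] that by (auto simp: g_def)
    moreover have "t < y" using y T1[OF t] True by (simp add: g_def)
    ultimately show ?thesis by (intro exI[of _ "{..<y}"]) auto
  next
    case False
    hence U1: "U t < 1" using U01[of t] by auto
    obtain d where d: "d > 0"
      "\<And>p. p \<in> {0..1} \<times> {0..1} \<Longrightarrow> dist p (U t, t) < d \<Longrightarrow>
         dist (case p of (s, r) \<Rightarrow> T s r) (T (U t) t) < y - g t"
      using Tc[unfolded continuous_on_iff, rule_format, of "(U t, t)" "y - g t"] U01[of t] t y
      by auto
    define a where "a = min 1 (U t + d / 3)"
    have a: "a \<in> {0..1}" "U t < a" "\<bar>a - U t\<bar> \<le> d / 3"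
      using U1 U01[of t] d(1) by (auto simp: a_def min_def)
    obtain m where m: "m < t" "\<And>r. r > m \<Longrightarrow> U r < a"
      using capacity_superlevel_usc[OF X \<nu> f a(1), of t] a(2) unfolding U_def by blast
    have "g r < y" if r: "r > m" "\<bar>r - t\<bar> < d / 3" "r \<in> {0..1}" for r
    proof -
      have "dist (a, r) (U t, t) \<le> \<bar>a - U t\<bar> + \<bar>r - t\<bar>"
        by (simp add: dist_Pair_Pair dist_real_def sqrt_sum_squares_le_sum_abs)
      hence "dist (T a r) (T (U t) t) < y - g t"
        using d(2)[of "(a, r)"] a r d(1) by auto
      hence "T a r < y" by (auto simp: dist_real_def g_def)
      thus ?thesis using Tm[OF U01 a(1) r(3), of r] m(2)[OF r(1)] by (simp add: g_def)
    qed
    thus ?thesis using m(1) d(1)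
      by (intro exI[of _ "{m<..} \<inter> ball t (d / 3)"]) (auto simp: dist_real_def abs_minus_commute)
  qed
  have "\<exists>t\<in>{0..1}. \<forall>s\<in>{0..1}. g s \<le> g t"
  proof (rule ccontr)
    assume "\<not> ?thesis"
    hence "\<forall>t\<in>{0..1}. \<exists>s. s \<in> {0..1} \<and> g t < g s" by (meson not_le)
    then obtain S where S: "\<And>t. t \<in> {0..1} \<Longrightarrow> S t \<in> {0..1} \<and> g t < g (S t)" by metis
    hence "\<forall>t\<in>{0..1}. \<exists>N. open N \<and> t \<in> N \<and> (\<forall>r\<in>N \<inter> {0..1}. g r < g (S t))"
      using usc by blast
    then obtain N where N: "\<And>t. t \<in> {0..1} \<Longrightarrow> open (N t) \<and> t \<in> N t \<and>
        (\<forall>r\<in>N t \<inter> {0..1}. g r < g (S t))" by metis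
    have "compact {0..1::real}" by simp
    from compactE_image[OF this, of "{0..1}" N] N
    obtain C where C: "C \<subseteq> {0..1}" "finite C" "{0..1} \<subseteq> (\<Union>c\<in>C. N c)" by blast
    have "C \<noteq> {}" using C(3) by auto
    hence ne: "(\<lambda>c. g (S c)) ` C \<noteq> {}" "finite ((\<lambda>c. g (S c)) ` C)" using C(2) by auto
    from Max_in[OF ne(2,1)] obtain c where c: "c \<in> C" "Max ((\<lambda>c. g (S c)) ` C) = g (S c)" by auto
    hence "S c \<in> {0..1}" using S C(1) by blast
    then obtain e where e: "e \<in> C" "S c \<in> N e" using C(3) by blast
    hence "g (S c) < g (S e)" using N[of e] C(1) \<open>S c \<in> {0..1}\<close> by blast
    moreover have "g (S e) \<le> g (S c)" using Max_ge[OF ne(2)] e(1) c(2) by auto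
    ultimately show False by simp
  qed
  then obtain t where t: "t \<in> {0..1}" "\<And>s. s \<in> {0..1} \<Longrightarrow> g s \<le> g t" by blast
  have V: "t_values X T \<nu> f = g ` {0..1}" by (auto simp: t_values_def g_def U_def)
  have I: "t_integral X T \<nu> f = g t"
    unfolding t_integral_def V by (rule Greatest_equality) (use t in auto)
  show "t_integral X T \<nu> f \<in> t_values X T \<nu> f" using t(1) by (simp add: I V)
  show "y \<in> t_values X T \<nu> f \<Longrightarrow> y \<le> t_integral X T \<nu> f" using t(2) by (auto simp: I V)
qed

end

theory Submission
  imports Defs
begin

text \<open>
  The capacity representing \<open>I\<close> is \<open>\<nu> F = inf {I \<phi> | \<phi> = 1 on F}\<close>. A functional that is only
  comonotonically maxitive need not be compared on arbitrary \<open>f \<le> g\<close>: it suffices to compare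
  nondecreasing functions of one and the same \<open>f\<close>, and functions \<open>f \<le> g\<close> with \<open>g = 1\<close> on the
  support of \<open>f\<close>; both kinds of pairs are comonotone. For the inequality \<open>I f \<le> \<integral> f d\<nu>\<close> one climbs
  from \<open>min f s\<close> to \<open>min f t\<close> in small steps, using
  \<open>min f t \<le> max (min f s) (t * h f)\<close> where \<open>h\<close> is a ramp from \<open>0\<close> at some \<open>r < s\<close> to \<open>1\<close> at \<open>s\<close>,
  together with the uniform continuity of the t-norm. Uniqueness follows from Urysohn's lemma.
\<close>

section \<open>Continuous t-norms\<close>

locale cont_t_norm =
  fixes T :: "real \<Rightarrow> real \<Rightarrow> real"
  assumes cont_t_norm: "continuous_t_norm T"
begin

lemma T_range: "s \<in> {0..1} \<Longrightarrow> t \<in> {0..1} \<Longrightarrow> T s t \<in> {0..1}"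
  and T_assoc: "r \<in> {0..1} \<Longrightarrow> s \<in> {0..1} \<Longrightarrow> t \<in> {0..1} \<Longrightarrow> T (T r s) t = T r (T s t)"
  and T_comm: "s \<in> {0..1} \<Longrightarrow> t \<in> {0..1} \<Longrightarrow> T s t = T t s"
  and T_one_right: "s \<in> {0..1} \<Longrightarrow> T s 1 = s"
  using cont_t_norm unfolding continuous_t_norm_def t_norm_def by blast+

lemma T_mono:
  assumes "s \<in> {0..1}" "s' \<in> {0..1}" "t \<in> {0..1}" "t' \<in> {0..1}" "s \<le> s'" "t \<le> t'"
  shows "T s t \<le> T s' t'"
proof -
  have "T s t \<le> T s' t" "T s' t \<le> T s' t'"
    using cont_t_norm assms unfolding continuous_t_norm_def t_norm_def by blast+
  thus ?thesis by linarith
qed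

lemma T_one_left: "s \<in> {0..1} \<Longrightarrow> T 1 s = s"
  using T_comm[of 1 s] T_one_right by simp

lemma T_le_left: "s \<in> {0..1} \<Longrightarrow> t \<in> {0..1} \<Longrightarrow> T s t \<le> s"
  using T_mono[of s s t 1] T_one_right by simp

lemma T_le_right: "s \<in> {0..1} \<Longrightarrow> t \<in> {0..1} \<Longrightarrow> T s t \<le> t"
  using T_le_left T_comm by metis

lemma T_zero_right: "s \<in> {0..1} \<Longrightarrow> T s 0 = 0"
  using T_le_right[of s 0] T_range[of s 0] by simp

lemma T_zero_left: "s \<in> {0..1} \<Longrightarrow> T 0 s = 0"
  using T_comm[of 0 s] T_zero_right by simp

lemma T_continuous: "continuous_on ({0..1} \<times> {0..1}) (\<lambda>(s, t). T s t)"
  using cont_t_norm by (simp add: continuous_t_norm_def)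

lemma T_continuous_right:
  assumes "c \<in> {0..1}"
  shows "continuous_on {0..1} (T c)"
proof -
  have "continuous_on {0..1} (\<lambda>t. case (c, t) of (s, t) \<Rightarrow> T s t)"
    by (rule continuous_on_compose2[OF T_continuous
          continuous_on_Pair[OF continuous_on_const continuous_on_id]]) (use assms in auto)
  thus ?thesis by simp
qed

text \<open>Heine-Cantor on the compact unit square. The point is that \<open>d\<close> does not
  depend on \<open>t\<close>: later \<open>t\<close> is a value of the functional or of a capacity
  that itself varies with the levels being compared.\<close>

lemma T_uniformly_continuous:
  assumes "e > 0"
  obtains d where "d > 0"
    "\<And>s s' t. s \<in> {0..1} \<Longrightarrow> s' \<in> {0..1} \<Longrightarrow> t \<in> {0..1} \<Longrightarrow> \<bar>s - s'\<bar> < d \<Longrightarrow> \<bar>T s t - T s' t\<bar> < e"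
proof -
  have "uniformly_continuous_on ({0..1} \<times> {0..1}) (\<lambda>(s, t). T s t)"
    by (intro compact_uniformly_continuous T_continuous compact_Times) auto
  then obtain d where d: "d > 0" "\<And>p q. p \<in> {0..1} \<times> {0..1} \<Longrightarrow> q \<in> {0..1} \<times> {0..1} \<Longrightarrow>
      dist q p < d \<Longrightarrow> dist (case q of (s, t) \<Rightarrow> T s t) (case p of (s, t) \<Rightarrow> T s t) < e"
    using assms unfolding uniformly_continuous_on_def by meson
  show thesis
  proof
    fix s s' t :: real
    assume "s \<in> {0..1}" "s' \<in> {0..1}" "t \<in> {0..1}" "\<bar>s - s'\<bar> < d"
    thus "\<bar>T s t - T s' t\<bar> < e"
      using d(2)[of "(s', t)" "(s, t)"] by (auto simp: dist_Pair_Pair dist_real_def)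
  qed (fact d(1))
qed

end

section \<open>Functions of a continuous function\<close>

text \<open>Composing such functions with one fixed \<open>f\<close> stays in
  \<open>cont01 X\<close> and always yields comonotone pairs; this is the main supply of pairs to
  which maxitivity applies.\<close>

definition mono01 :: "(real \<Rightarrow> real) \<Rightarrow> bool" where
  "mono01 p \<longleftrightarrow> continuous_on {0..1} p \<and> p ` {0..1} \<subseteq> {0..1} \<and> mono_on {0..1} p"

definition comp_on :: "'a topology \<Rightarrow> (real \<Rightarrow> real) \<Rightarrow> ('a \<Rightarrow> real) \<Rightarrow> 'a \<Rightarrow> real" where
  "comp_on X p f = (\<lambda>x\<in>topspace X. p (f x))"

text \<open>For \<open>s < t\<close>, a continuous stand-in for the indicator of a superlevel set.
  The endpoints need not lie in the unit interval: a ramp starting at \<open>-1\<close> occurs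
  below.\<close>

definition ramp :: "real \<Rightarrow> real \<Rightarrow> real \<Rightarrow> real" where
  "ramp s t u = min 1 (max 0 ((u - s) / (t - s)))"

lemma comp_on_apply [simp]: "x \<in> topspace X \<Longrightarrow> comp_on X p f x = p (f x)"
  by (simp add: comp_on_def)

lemma cont01_range: "f \<in> cont01 X \<Longrightarrow> x \<in> topspace X \<Longrightarrow> f x \<in> {0..1}"
  by (auto simp: cont01_def)

lemma comp_on_id: "f \<in> cont01 X \<Longrightarrow> comp_on X (\<lambda>u. u) f = f"
  by (auto simp: comp_on_def cont01_def)

lemma cont01_comp_on:
  assumes "f \<in> cont01 X" "continuous_on {0..1} p" "p ` {0..1} \<subseteq> {0..1}"
  shows "comp_on X p f \<in> cont01 X"
proof -
  have "continuous_map X (top_of_set {0..1}) f"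
    using assms(1) by (auto simp: cont01_def continuous_map_in_subtopology)
  moreover have "continuous_map (top_of_set {0..1}) euclideanreal p"
    using assms(2) by simp
  ultimately have "continuous_map X euclideanreal (p \<circ> f)"
    by (rule continuous_map_compose)
  hence "continuous_map X euclideanreal (comp_on X p f)"
    by (rule continuous_map_eq) simp
  thus ?thesis using assms(3) cont01_range[OF assms(1)]
    by (auto simp: cont01_def comp_on_def image_subset_iff)
qed

lemma cont01_mono01: "f \<in> cont01 X \<Longrightarrow> mono01 p \<Longrightarrow> comp_on X p f \<in> cont01 X"
  by (simp add: cont01_comp_on mono01_def)

lemma comonotone_comp_on:
  assumes "f \<in> cont01 X" "mono01 p" "mono01 q"
  shows "comonotone X (comp_on X p f) (comp_on X q f)"
  unfolding comonotone_def
proof (intro ballI)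
  fix x y assume xy: "x \<in> topspace X" "y \<in> topspace X"
  have m: "p u \<le> p v \<and> q u \<le> q v" if "u \<in> {0..1}" "v \<in> {0..1}" "u \<le> v" for u v
    using assms(2,3) that by (auto simp: mono01_def mono_on_def)
  show "0 \<le> (comp_on X p f x - comp_on X p f y) * (comp_on X q f x - comp_on X q f y)"
    using m[of "f x" "f y"] m[of "f y" "f x"] xy cont01_range[OF assms(1)]
    by (cases "f x \<le> f y") (auto intro: mult_nonneg_nonneg mult_nonpos_nonpos)
qed

lemma pointwise_max_comp_on:
  "pointwise X max (comp_on X p f) (comp_on X q f) = comp_on X (\<lambda>u. max (p u) (q u)) f"
  by (auto simp: pointwise_def comp_on_def)

text \<open>Homogeneity thereby becomes a statement about composition with \<open>T c\<close>, the
  form used in the locales.\<close>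

lemma pointwise_const_comp_on: "pointwise X T (const_on X c) f = comp_on X (T c) f"
  by (auto simp: pointwise_def comp_on_def const_on_def)

lemma comp_on_comp_on: "comp_on X p (comp_on X q f) = comp_on X (\<lambda>u. p (q u)) f"
  by (auto simp: comp_on_def)

lemma mono01_id: "mono01 (\<lambda>u. u)"
  by (auto simp: mono01_def mono_on_def)

lemma mono01_min: "c \<in> {0..1} \<Longrightarrow> mono01 (\<lambda>u. min u c)"
  by (auto simp: mono01_def mono_on_def intro!: continuous_intros)

lemma mono01_max: "mono01 p \<Longrightarrow> mono01 q \<Longrightarrow> mono01 (\<lambda>u. max (p u) (q u))"
  unfolding mono01_def
  by (auto simp: image_subset_iff le_max_iff_disj intro!: continuous_intros mono_onI max.mono
      dest: mono_onD)

lemma mono01_ramp: "s < t \<Longrightarrow> mono01 (ramp s t)"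
  unfolding mono01_def ramp_def
  by (auto simp: image_subset_iff divide_right_mono intro!: continuous_intros mono_onI
      min.mono[OF order_refl] max.mono)

lemma ramp_eq_0: "s < t \<Longrightarrow> u \<le> s \<Longrightarrow> ramp s t u = 0"
  by (auto simp: ramp_def divide_le_0_iff)

lemma ramp_eq_1: "s < t \<Longrightarrow> t \<le> u \<Longrightarrow> ramp s t u = 1"
  by (auto simp: ramp_def)

lemma ramp_range: "ramp s t u \<in> {0..1}"
  by (auto simp: ramp_def)

lemma const_on_cont01: "c \<in> {0..1} \<Longrightarrow> const_on X c \<in> cont01 X"
  by (auto simp: const_on_def cont01_def intro: continuous_map_eq[of X _ "\<lambda>x. c"])

lemma (in cont_t_norm) mono01_T: "c \<in> {0..1} \<Longrightarrow> mono01 p \<Longrightarrow> mono01 (\<lambda>u. T c (p u))"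
  unfolding mono01_def
proof (elim conjE, intro conjI)
  assume c: "c \<in> {0..1}" and p: "continuous_on {0..1} p" "p ` {0..1} \<subseteq> {0..1}" "mono_on {0..1} p"
  show "continuous_on {0..1} (\<lambda>u. T c (p u))"
    by (rule continuous_on_compose2[OF T_continuous_right[OF c] p(1,2)])
  show "(\<lambda>u. T c (p u)) ` {0..1} \<subseteq> {0..1}" using p(2) T_range[OF c] by blast
  show "mono_on {0..1} (\<lambda>u. T c (p u))"
    using c p(2,3) by (intro mono_onI T_mono) (auto simp: mono_on_def image_subset_iff)
qed

section \<open>The integral is a comonotonically maxitive homogeneous functional\<close>

lemma superlevel_eq:
  "f \<in> cont01 X \<Longrightarrow> {x \<in> topspace X. f x \<in> {t..1}} = {x \<in> topspace X. t \<le> f x}"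
  using cont01_range by fastforce

lemma closedin_superlevel': "f \<in> cont01 X \<Longrightarrow> closedin X {x \<in> topspace X. t \<le> f x}"
  using closedin_superlevel superlevel_eq by metis

lemma t_values_eq:
  "f \<in> cont01 X \<Longrightarrow> t_values X T \<nu> f = {T (\<nu> {x \<in> topspace X. t \<le> f x}) t |t. t \<in> {0..1}}"
  unfolding t_values_def by (simp only: superlevel_eq)

locale compactum_capacity = cont_t_norm T for T +
  fixes X :: "'a topology" and \<nu> :: "'a set \<Rightarrow> real"
  assumes compact_X: "compact_space X" and Hausdorff_X: "Hausdorff_space X"
    and capacity_\<nu>: "capacity X \<nu>"
begin

lemma \<nu>_range: "closedin X F \<Longrightarrow> \<nu> F \<in> {0..1}"
  and \<nu>_mono: "closedin X F \<Longrightarrow> closedin X G \<Longrightarrow> F \<subseteq> G \<Longrightarrow> \<nu> F \<le> \<nu> G"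
  and \<nu>_top: "\<nu> (topspace X) = 1"
  and \<nu>_empty: "\<nu> {} = 0"
  using capacity_\<nu> unfolding capacity_def by blast+

lemma t_integral_ge:
  assumes "f \<in> cont01 X" "t \<in> {0..1}"
  shows "T (\<nu> {x \<in> topspace X. t \<le> f x}) t \<le> t_integral X T \<nu> f"
  using t_integral_is_max(2)[OF compact_X Hausdorff_X cont_t_norm capacity_\<nu> assms(1)] assms
  unfolding t_values_eq[OF assms(1)] by blast

lemma t_integral_attained:
  assumes "f \<in> cont01 X"
  obtains t where "t \<in> {0..1}" "t_integral X T \<nu> f = T (\<nu> {x \<in> topspace X. t \<le> f x}) t"
  using t_integral_is_max(1)[OF compact_X Hausdorff_X cont_t_norm capacity_\<nu> assms]
  unfolding t_values_eq[OF assms] by blast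

lemma t_integral_one: "t_integral X T \<nu> (const_on X 1) = 1"
proof -
  have f: "const_on X 1 \<in> cont01 X" by (rule const_on_cont01) simp
  have level: "{x \<in> topspace X. t \<le> const_on X 1 x} = topspace X" if "t \<in> {0..1}" for t
    using that by (auto simp: const_on_def)
  obtain t where t: "t \<in> {0..1}" "t_integral X T \<nu> (const_on X 1) = T 1 t"
    using t_integral_attained[OF f] level \<nu>_top by metis
  have "T 1 1 \<le> t_integral X T \<nu> (const_on X 1)"
    using t_integral_ge[OF f, of 1] level[of 1] \<nu>_top by simp
  thus ?thesis using t T_one_left by auto
qed

lemma t_integral_le:
  assumes "f \<in> cont01 X" "\<And>t. t \<in> {0..1} \<Longrightarrow> T (\<nu> {x \<in> topspace X. t \<le> f x}) t \<le> M"
  shows "t_integral X T \<nu> f \<le> M"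
  using t_integral_attained[OF assms(1)] assms(2) by metis

lemma t_integral_mono:
  assumes "f \<in> cont01 X" "g \<in> cont01 X" "\<And>x. x \<in> topspace X \<Longrightarrow> f x \<le> g x"
  shows "t_integral X T \<nu> f \<le> t_integral X T \<nu> g"
proof (rule t_integral_le[OF assms(1)])
  fix t :: real assume t: "t \<in> {0..1}"
  have "{x \<in> topspace X. t \<le> f x} \<subseteq> {x \<in> topspace X. t \<le> g x}" using assms(3) by fastforce
  hence "T (\<nu> {x \<in> topspace X. t \<le> f x}) t \<le> T (\<nu> {x \<in> topspace X. t \<le> g x}) t"
    using t assms(1,2) by (intro T_mono \<nu>_range \<nu>_mono closedin_superlevel') auto
  thus "T (\<nu> {x \<in> topspace X. t \<le> f x}) t \<le> t_integral X T \<nu> g"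
    using t_integral_ge[OF assms(2) t] by linarith
qed

lemma cont01_max:
  assumes "f \<in> cont01 X" "g \<in> cont01 X"
  shows "pointwise X max f g \<in> cont01 X"
proof -
  have "continuous_map X euclideanreal (\<lambda>x. max (f x) (g x))"
    using assms by (intro continuous_map_real_max) (simp_all add: cont01_def)
  hence "continuous_map X euclideanreal (pointwise X max f g)"
    by (rule continuous_map_eq) (simp add: pointwise_def)
  moreover have "max (f x) (g x) \<in> {0..1}" if "x \<in> topspace X" for x
    using cont01_range[OF assms(1) that] cont01_range[OF assms(2) that] by (simp add: max_def)
  ultimately show ?thesis by (simp add: cont01_def pointwise_def del: atLeastAtMost_iff)
qed

text \<open>Comonotonicity makes the superlevel sets of \<open>f\<close> and \<open>g\<close> at a
  common level nested, so their union, the superlevel set of the maximum, is one of the two.\<close>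

lemma t_integral_max:
  assumes f: "f \<in> cont01 X" and g: "g \<in> cont01 X" and fg: "comonotone X f g"
  shows "t_integral X T \<nu> (pointwise X max f g) = max (t_integral X T \<nu> f) (t_integral X T \<nu> g)"
proof (rule antisym)
  let ?h = "pointwise X max f g"
  have h: "?h \<in> cont01 X" by (rule cont01_max[OF f g])
  show "max (t_integral X T \<nu> f) (t_integral X T \<nu> g) \<le> t_integral X T \<nu> ?h"
    using t_integral_mono[OF f h] t_integral_mono[OF g h] by (auto simp: pointwise_def)
  show "t_integral X T \<nu> ?h \<le> max (t_integral X T \<nu> f) (t_integral X T \<nu> g)"
  proof (rule t_integral_le[OF h])
    fix t :: real assume t: "t \<in> {0..1}"
    let ?F = "{x \<in> topspace X. t \<le> f x}" and ?G = "{x \<in> topspace X. t \<le> g x}"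
    have "{x \<in> topspace X. t \<le> ?h x} = ?F \<union> ?G"
      by (auto simp: pointwise_def le_max_iff_disj)
    moreover have "?F \<subseteq> ?G \<or> ?G \<subseteq> ?F"
    proof (rule ccontr)
      assume "\<not> ?thesis"
      then obtain x y where xy: "x \<in> topspace X" "t \<le> f x" "\<not> t \<le> g x"
        "y \<in> topspace X" "t \<le> g y" "\<not> t \<le> f y" by blast
      \<comment> \<open>Here \<open>f y < t \<le> f x\<close> while
        \<open>g x < t \<le> g y\<close>, so the two differences have opposite strict signs.\<close>
      hence "(f x - f y) * (g x - g y) < 0" by (intro mult_pos_neg) auto
      thus False using fg xy(1,4) unfolding comonotone_def by (meson not_le)
    qed
    ultimately have "{x \<in> topspace X. t \<le> ?h x} = ?F \<or> {x \<in> topspace X. t \<le> ?h x} = ?G"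
      by blast
    thus "T (\<nu> {x \<in> topspace X. t \<le> ?h x}) t \<le> max (t_integral X T \<nu> f) (t_integral X T \<nu> g)"
      using t_integral_ge[OF f t] t_integral_ge[OF g t] by auto
  qed
qed

text \<open>Levels of \<open>f\<close> and of its composite with \<open>T c\<close> correspond via
  the map from \<open>s\<close> to \<open>T c s\<close>, up to inclusions of superlevel sets;
  associativity and commutativity move \<open>c\<close> past the capacity.\<close>

lemma t_integral_T:
  assumes c: "c \<in> {0..1}" and f: "f \<in> cont01 X"
  shows "t_integral X T \<nu> (comp_on X (T c) f) = T c (t_integral X T \<nu> f)"
proof (rule antisym)
  let ?h = "comp_on X (T c) f"
  let ?L = "\<lambda>f t. {x \<in> topspace X. t \<le> f x}"
  have h: "?h \<in> cont01 X"
    using cont01_mono01[OF f mono01_T[OF c mono01_id]] .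
  have fr: "\<And>x. x \<in> topspace X \<Longrightarrow> f x \<in> {0..1}" by (rule cont01_range[OF f])
  have \<nu>f: "\<nu> (?L f s) \<in> {0..1}" for s by (intro \<nu>_range closedin_superlevel' f)
  have \<nu>h: "\<nu> (?L ?h s) \<in> {0..1}" for s by (intro \<nu>_range closedin_superlevel' h)
  have swap: "T c (T (\<nu> (?L f s)) s) = T (\<nu> (?L f s)) (T c s)" if "s \<in> {0..1}" for s
    using T_assoc[OF c \<nu>f that] T_assoc[OF \<nu>f c that] T_comm[OF c \<nu>f] by simp
  show "T c (t_integral X T \<nu> f) \<le> t_integral X T \<nu> ?h"
  proof -
    obtain s where s: "s \<in> {0..1}" "t_integral X T \<nu> f = T (\<nu> (?L f s)) s"
      using t_integral_attained[OF f] .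
    have "?L f s \<subseteq> ?L ?h (T c s)" using s(1) c fr by (auto intro!: T_mono)
    hence "T (\<nu> (?L f s)) (T c s) \<le> T (\<nu> (?L ?h (T c s))) (T c s)"
      using T_range[OF c s(1)] \<nu>f \<nu>h c s(1)
      by (intro T_mono \<nu>_mono closedin_superlevel' f h) auto
    also have "\<dots> \<le> t_integral X T \<nu> ?h" by (intro t_integral_ge h T_range c s)
    finally show ?thesis using s swap by simp
  qed
  show "t_integral X T \<nu> ?h \<le> T c (t_integral X T \<nu> f)"
  proof (rule t_integral_le[OF h])
    fix t :: real assume t: "t \<in> {0..1}"
    have I01: "t_integral X T \<nu> f \<in> {0..1}"
      using t_integral_attained[OF f] T_range \<nu>f by metis
    show "T (\<nu> (?L ?h t)) t \<le> T c (t_integral X T \<nu> f)"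
    proof (cases "?L ?h t = {}")
      \<comment> \<open>With an empty superlevel set there may be no \<open>s\<close> with
        \<open>t \<le> T c s\<close>, so this case cannot use the least such
        \<open>s\<close>.\<close>
      case True
      show ?thesis unfolding True \<nu>_empty T_zero_left[OF t] using T_range[OF c I01] by simp
    next
      case False
      \<comment> \<open>The least element \<open>s\<close> of \<open>S\<close> is the matching level
        of \<open>f\<close>: if \<open>t \<le> T c (f x)\<close> then \<open>f x\<close> lies in
        \<open>S\<close>, hence \<open>s \<le> f x\<close>. Continuity of \<open>T c\<close> makes
        the minimum attained.\<close>
      define S where "S = {s \<in> {0..1}. t \<le> T c s}"
      have "S = {0..1} \<inter> T c -` {t..}" by (auto simp: S_def)
      hence "closed S"
        using continuous_closed_preimage[OF T_continuous_right[OF c], of "{t..}"] by simp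
      moreover have "bounded S" by (rule bounded_subset[of "{0..1}"]) (auto simp: S_def)
      ultimately have "compact S" by (simp add: compact_eq_bounded_closed)
      moreover have "S \<noteq> {}" using False fr by (auto simp: S_def)
      ultimately obtain s where s: "s \<in> S" "\<And>u. u \<in> S \<Longrightarrow> s \<le> u"
        using compact_attains_inf[of S] by metis
      hence s01: "s \<in> {0..1}" and ts: "t \<le> T c s" by (auto simp: S_def)
      have "?L ?h t \<subseteq> ?L f s" using s(2) fr by (auto simp: S_def)
      hence "T (\<nu> (?L ?h t)) t \<le> T (\<nu> (?L f s)) (T c s)"
        using \<nu>f \<nu>h t ts T_range[OF c s01] by (intro T_mono \<nu>_mono closedin_superlevel' f h) auto
      also have "\<dots> = T c (T (\<nu> (?L f s)) s)" using swap[OF s01] by simp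
      also have "\<dots> \<le> T c (t_integral X T \<nu> f)"
        using c I01 T_range[OF \<nu>f s01] by (intro T_mono t_integral_ge f s01) auto
      finally show ?thesis .
    qed
  qed
qed

end

section \<open>Uniqueness of the capacity\<close>

text \<open>Otherwise upper semicontinuity of \<open>\<nu>\<close> at the bound
  \<open>\<mu> F\<close> gives an open \<open>W\<close> around \<open>F\<close>. A Urysohn function
  equal to 1 on \<open>F\<close> and 0 off \<open>W\<close> has \<open>\<mu>\<close>-integral at
  least \<open>\<mu> F\<close> but \<open>\<nu>\<close>-integral below it.\<close>

lemma capacity_le_if_t_integral_le:
  assumes X: "compact_space X" "Hausdorff_space X" and T: "continuous_t_norm T"
    and \<mu>: "capacity X \<mu>" and \<nu>: "capacity X \<nu>"
    and le: "\<And>f. f \<in> cont01 X \<Longrightarrow> t_integral X T \<mu> f \<le> t_integral X T \<nu> f"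
    and F: "closedin X F"
  shows "\<mu> F \<le> \<nu> F"
proof (rule ccontr)
  interpret M: compactum_capacity T X \<mu> by unfold_locales (fact X T \<mu>)+
  interpret N: compactum_capacity T X \<nu> by unfold_locales (fact X T \<nu>)+
  assume "\<not> \<mu> F \<le> \<nu> F"
  hence less: "\<nu> F < \<mu> F" by simp
  then obtain W where W: "openin X W" "F \<subseteq> W" "\<And>B. compactin X B \<Longrightarrow> B \<subseteq> W \<Longrightarrow> \<nu> B < \<mu> F"
    using \<nu> F M.\<nu>_range[OF F] unfolding capacity_def by meson
  have "normal_space X" using X compact_Hausdorff_or_regular_imp_normal_space by blast
  moreover have "disjnt (topspace X - W) F" using W(2) by (auto simp: disjnt_def)
  moreover have "closedin X (topspace X - W)" using W(1) by blast
  ultimately obtain g where g: "continuous_map X (top_of_set {0..1::real}) g"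
    "g ` (topspace X - W) \<subseteq> {0}" "g ` F \<subseteq> {1}"
    using Urysohn_lemma[of X "topspace X - W" F 0 1] F by force
  define f where "f = restrict g (topspace X)"
  have f: "f \<in> cont01 X"
    using g(1) unfolding cont01_def f_def
    by (auto simp: continuous_map_in_subtopology intro: continuous_map_eq[of X _ g])
  have "F \<subseteq> {x \<in> topspace X. 1 \<le> f x}"
    using g(3) closedin_subset[OF F] by (auto simp: f_def)
  hence "\<mu> F \<le> \<mu> {x \<in> topspace X. 1 \<le> f x}" by (intro M.\<nu>_mono F closedin_superlevel' f)
  also have "\<dots> = T (\<mu> {x \<in> topspace X. 1 \<le> f x}) 1"
    by (simp only: M.T_one_right M.\<nu>_range closedin_superlevel' f)
  also have "\<dots> \<le> t_integral X T \<nu> f" using M.t_integral_ge[OF f, of 1] le[OF f] by simp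
  finally have *: "\<mu> F \<le> t_integral X T \<nu> f" .
  obtain t where t: "t \<in> {0..1}" "t_integral X T \<nu> f = T (\<nu> {x \<in> topspace X. t \<le> f x}) t"
    using N.t_integral_attained[OF f] .
  have \<nu>f: "\<nu> {x \<in> topspace X. t \<le> f x} \<in> {0..1}" by (intro N.\<nu>_range closedin_superlevel' f)
  show False
  \<comment> \<open>At level 0 the superlevel set is the whole space and need not lie in
    \<open>W\<close>, but there \<open>T\<close> returns 0.\<close>
  proof (cases "t = 0")
    case True
    thus False using * t M.T_zero_right[OF \<nu>f] less N.\<nu>_range[OF F] by simp
  next
    case False
    have "{x \<in> topspace X. t \<le> f x} \<subseteq> W"
      using g(2) False t(1) by (fastforce simp: f_def)
    moreover have "compactin X {x \<in> topspace X. t \<le> f x}"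
      by (intro closedin_compact_space X closedin_superlevel' f)
    ultimately have "\<nu> {x \<in> topspace X. t \<le> f x} < \<mu> F" by (intro W(3))
    thus False using * t M.T_le_left[OF \<nu>f t(1)] by simp
  qed
qed

lemma capacity_eq_if_t_integral_eq:
  assumes "compact_space X" "Hausdorff_space X" "continuous_t_norm T"
    and \<mu>: "capacity X \<mu>" and \<nu>: "capacity X \<nu>"
    and "\<And>f. f \<in> cont01 X \<Longrightarrow> t_integral X T \<mu> f = t_integral X T \<nu> f"
  shows "\<mu> = \<nu>"
proof (rule PiE_ext)
  show "\<mu> \<in> {F. closedin X F} \<rightarrow>\<^sub>E {0..1}" "\<nu> \<in> {F. closedin X F} \<rightarrow>\<^sub>E {0..1}"
    using \<mu> \<nu> by (auto simp: capacity_def)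
  show "\<mu> F = \<nu> F" if "F \<in> {F. closedin X F}" for F
    using that assms capacity_le_if_t_integral_le[of X T \<mu> \<nu> F]
      capacity_le_if_t_integral_le[of X T \<nu> \<mu> F] by (intro antisym) auto
qed

section \<open>The capacity of a functional\<close>

locale maxitive_functional = cont_t_norm T for T +
  fixes X :: "'a topology" and I :: "('a \<Rightarrow> real) \<Rightarrow> real"
  assumes compact_X: "compact_space X" and Hausdorff_X: "Hausdorff_space X"
    and I_range: "f \<in> cont01 X \<Longrightarrow> I f \<in> {0..1}"
    and I_one: "I (const_on X 1) = 1"
    and I_max: "f \<in> cont01 X \<Longrightarrow> g \<in> cont01 X \<Longrightarrow> comonotone X f g \<Longrightarrow>
      I (pointwise X max f g) = max (I f) (I g)"
    and I_T: "c \<in> {0..1} \<Longrightarrow> f \<in> cont01 X \<Longrightarrow> I (comp_on X (T c) f) = T c (I f)"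
begin

text \<open>If \<open>f \<le> g\<close>, their maximum is \<open>g\<close>, and maxitivity compares
  the values. Equality with \<open>g\<close> as functions rests on extensionality.\<close>

lemma I_mono_comonotone:
  assumes "f \<in> cont01 X" "g \<in> cont01 X" "comonotone X f g"
    and le: "\<And>x. x \<in> topspace X \<Longrightarrow> f x \<le> g x"
  shows "I f \<le> I g"
proof -
  have "pointwise X max f g = g"
    using assms(2) le by (fastforce simp: pointwise_def cont01_def)
  thus ?thesis using I_max[OF assms(1-3)] by simp
qed

lemma I_mono_comp_on:
  assumes "f \<in> cont01 X" "mono01 p" "mono01 q" "\<And>u. u \<in> {0..1} \<Longrightarrow> p u \<le> q u"
  shows "I (comp_on X p f) \<le> I (comp_on X q f)"
  using assms cont01_range[OF assms(1)]
  by (intro I_mono_comonotone cont01_mono01 comonotone_comp_on) auto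

text \<open>Comonotone because \<open>g\<close> attains its largest possible value wherever
  \<open>f\<close> is nonzero: two such points give equal values of \<open>g\<close>, and passing
  from a zero of \<open>f\<close> to such a point decreases neither function.\<close>

lemma I_mono_support:
  assumes f: "f \<in> cont01 X" and g: "g \<in> cont01 X"
    and supp: "\<And>x. x \<in> topspace X \<Longrightarrow> f x \<noteq> 0 \<Longrightarrow> g x = 1"
  shows "I f \<le> I g"
proof (rule I_mono_comonotone[OF f g])
  show "f x \<le> g x" if "x \<in> topspace X" for x
    using supp[OF that] cont01_range[OF f that] cont01_range[OF g that] by (cases "f x = 0") auto
  show "comonotone X f g"
    unfolding comonotone_def
  proof (intro ballI)
    fix x y assume xy: "x \<in> topspace X" "y \<in> topspace X"
    show "0 \<le> (f x - f y) * (g x - g y)"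
      using supp[OF xy(1)] supp[OF xy(2)] cont01_range[OF f xy(1)] cont01_range[OF f xy(2)]
        cont01_range[OF g xy(1)] cont01_range[OF g xy(2)]
      by (cases "f x = 0"; cases "f y = 0")
        (auto intro: mult_nonneg_nonneg simp: mult_nonneg_nonneg mult_nonneg_nonpos)
  qed
qed

lemma I_zero: "I (const_on X 0) = 0"
proof -
  have f: "const_on X 1 \<in> cont01 X" by (rule const_on_cont01) simp
  have "comp_on X (T 0) (const_on X 1) = const_on X 0"
    using T_zero_left[of 1] by (auto simp: comp_on_def const_on_def)
  thus ?thesis using I_T[OF _ f, of 0] I_one T_zero_left[of 1] by simp
qed

section \<open>The capacity induced by the functional\<close>

text \<open>Each admissible \<open>\<phi>\<close> is a continuous majorant of the indicator of
  \<open>F\<close>, so the infimum approximates \<open>F\<close> from outside. The restriction to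
  closed sets makes it extensional, as \<open>capacity\<close> demands.\<close>

definition cap :: "'a set \<Rightarrow> real" where
  "cap = (\<lambda>F\<in>{F. closedin X F}. Inf (I ` {\<phi> \<in> cont01 X. \<forall>x\<in>F. \<phi> x = 1}))"

lemma bdd_below_cap: "bdd_below (I ` {\<phi> \<in> cont01 X. \<forall>x\<in>F. \<phi> x = 1})"
  using I_range by (intro bdd_belowI[of _ 0]) auto

text \<open>Keeps the set under the infimum nonempty, so that \<open>Inf\<close> has its usual
  meaning.\<close>

lemma one_admissible:
  assumes "closedin X F"
  shows "const_on X 1 \<in> {\<phi> \<in> cont01 X. \<forall>x\<in>F. \<phi> x = 1}"
  using const_on_cont01[of 1 X] closedin_subset[OF assms] by (auto simp: const_on_def)

lemma cap_le:
  assumes "closedin X F" "\<phi> \<in> cont01 X" "\<And>x. x \<in> F \<Longrightarrow> \<phi> x = 1"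
  shows "cap F \<le> I \<phi>"
  using assms bdd_below_cap by (auto simp: cap_def intro!: cInf_lower)

lemma cap_ge:
  assumes "closedin X F" "\<And>\<phi>. \<phi> \<in> cont01 X \<Longrightarrow> (\<And>x. x \<in> F \<Longrightarrow> \<phi> x = 1) \<Longrightarrow> M \<le> I \<phi>"
  shows "M \<le> cap F"
  using assms one_admissible[OF assms(1)] by (auto simp: cap_def intro!: cInf_greatest)

lemma cap_lessE:
  assumes "closedin X F" "cap F < a"
  obtains \<phi> where "\<phi> \<in> cont01 X" "\<And>x. x \<in> F \<Longrightarrow> \<phi> x = 1" "I \<phi> < a"
  using cap_ge[OF assms(1), of a] assms(2) by (meson not_le)

lemma cap_range: "closedin X F \<Longrightarrow> cap F \<in> {0..1}"
  using cap_ge[of F 0] cap_le[of F "const_on X 1"] one_admissible[of F] I_range I_one by auto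

text \<open>Pointwise \<open>T s (ramp s t u) \<le> u\<close>: the left side is 0 for
  \<open>u \<le> s\<close> and never exceeds \<open>s\<close>. It recovers a bound by
  \<open>I f\<close> after \<open>f\<close> has been replaced by a ramp.\<close>

lemma T_I_ramp_le:
  assumes f: "f \<in> cont01 X" and s: "s \<in> {0..1}" and st: "s < t"
  shows "T s (I (comp_on X (ramp s t) f)) \<le> I f"
proof -
  have r: "comp_on X (ramp s t) f \<in> cont01 X" by (intro cont01_mono01 f mono01_ramp st)
  have "T s (I (comp_on X (ramp s t) f)) = I (comp_on X (\<lambda>u. T s (ramp s t u)) f)"
    using I_T[OF s r] by (simp add: comp_on_comp_on)
  also have "\<dots> \<le> I (comp_on X (\<lambda>u. u) f)"
  proof (intro I_mono_comp_on f mono01_T s mono01_ramp st mono01_id)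
    fix u :: real assume u: "u \<in> {0..1}"
    show "T s (ramp s t u) \<le> u"
      using ramp_eq_0[OF st, of u] T_zero_right[OF s] T_le_left[OF s ramp_range, of s t u] u
      by (cases "u \<le> s") auto
  qed
  also have "\<dots> = I f" by (simp add: comp_on_id f)
  finally show ?thesis .
qed

text \<open>An admissible \<open>\<phi>\<close> with \<open>I \<phi> < a\<close> equals 1 only on
  \<open>F\<close> for sure. A ramp ending just below 1 makes it 1 on a whole neighbourhood, and
  uniform continuity of \<open>T\<close> keeps the functional below \<open>a\<close>.\<close>

lemma cap_usc:
  assumes F: "closedin X F" and a: "cap F < a"
  shows "\<exists>W. openin X W \<and> F \<subseteq> W \<and> (\<forall>B. compactin X B \<longrightarrow> B \<subseteq> W \<longrightarrow> cap B < a)"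
proof -
  obtain \<phi> where \<phi>: "\<phi> \<in> cont01 X" "\<And>x. x \<in> F \<Longrightarrow> \<phi> x = 1" "I \<phi> < a"
    using cap_lessE[OF F a] by metis
  obtain d where d: "d > 0" "\<And>s s' t. s \<in> {0..1} \<Longrightarrow> s' \<in> {0..1} \<Longrightarrow> t \<in> {0..1} \<Longrightarrow>
      \<bar>s - s'\<bar> < d \<Longrightarrow> \<bar>T s t - T s' t\<bar> < a - I \<phi>"
    using T_uniformly_continuous[of "a - I \<phi>"] \<phi>(3) by auto
  \<comment> \<open>The maximum with 0 keeps \<open>s\<close> in the unit interval when
    \<open>d\<close> is large.\<close>
  define s where "s = max 0 (1 - d / 2)"
  have s: "s \<in> {0..1}" "\<bar>1 - s\<bar> < d" "s < 1" using d(1) by (auto simp: s_def)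
  \<comment> \<open>Strictly between \<open>s\<close> and 1, so the open set where
    \<open>\<phi>\<close> exceeds \<open>t\<close> contains \<open>F\<close> and the ramp is 1 on
    it.\<close>
  define t where "t = (s + 1) / 2"
  have st: "s < t" "t < 1" using s(3) by (auto simp: t_def)
  let ?\<psi> = "comp_on X (ramp s t) \<phi>"
  have \<psi>: "?\<psi> \<in> cont01 X" by (intro cont01_mono01 \<phi> mono01_ramp st)
  have "\<bar>T 1 (I ?\<psi>) - T s (I ?\<psi>)\<bar> < a - I \<phi>" using d(2)[of 1 s] s I_range[OF \<psi>] by auto
  hence I\<psi>: "I ?\<psi> < a"
    using T_one_left[OF I_range[OF \<psi>]] T_I_ramp_le[OF \<phi>(1) s(1) st(1)] by simp
  define W where "W = {x \<in> topspace X. \<phi> x \<in> {t<..}}"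
  have "openin X W" unfolding W_def
    using \<phi>(1) by (intro openin_continuous_map_preimage[of X euclideanreal]) (auto simp: cont01_def)
  moreover have "F \<subseteq> W" using \<phi>(2) st closedin_subset[OF F] by (auto simp: W_def)
  moreover have "cap B < a" if "compactin X B" "B \<subseteq> W" for B
  proof -
    have "closedin X B" using compactin_imp_closedin[OF Hausdorff_X that(1)] .
    hence "cap B \<le> I ?\<psi>"
      using that(2) by (intro cap_le \<psi>) (auto simp: W_def ramp_eq_1 st)
    thus ?thesis using I\<psi> by simp
  qed
  ultimately show ?thesis by blast
qed

lemma capacity_cap: "capacity X cap"
  unfolding capacity_def
proof (intro conjI allI impI ballI)
  show "cap \<in> {F. closedin X F} \<rightarrow>\<^sub>E {0..1}"
    using cap_range by (auto simp: cap_def)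
  have "1 \<le> cap (topspace X)"
  proof (rule cap_ge)
    fix \<phi> assume "\<phi> \<in> cont01 X" "\<And>x. x \<in> topspace X \<Longrightarrow> \<phi> x = 1"
    hence "\<phi> = const_on X 1" by (auto simp: const_on_def cont01_def fun_eq_iff)
    thus "1 \<le> I \<phi>" using I_one by simp
  qed simp
  thus "cap (topspace X) = 1" using cap_range[of "topspace X"] by simp
  \<comment> \<open>Over the empty set the constant 0 is vacuously admissible.\<close>
  show "cap {} = 0"
    using cap_le[of "{}" "const_on X 0"] const_on_cont01[of 0 X] I_zero cap_range[of "{}"] by auto
  show "cap F \<le> cap G" if "closedin X F" "closedin X G" "F \<subseteq> G" for F G
    using that by (intro cap_ge cap_le) auto
  show "\<exists>W. openin X W \<and> F \<subseteq> W \<and> (\<forall>B. compactin X B \<longrightarrow> B \<subseteq> W \<longrightarrow> cap B < a)"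
    if "closedin X F" "cap F < a" for F a
    using cap_usc[OF that] .
qed

sublocale cap: compactum_capacity T X cap
  by unfold_locales (fact compact_X Hausdorff_X capacity_cap)+

section \<open>The two inequalities between the functional and the integral\<close>

text \<open>For \<open>s < t\<close> the ramp of \<open>f\<close> from \<open>s\<close> to
  \<open>t\<close> is admissible for the superlevel set at \<open>t\<close>, which bounds
  \<open>T s ?c\<close> by \<open>I f\<close>; then \<open>s\<close> tends to
  \<open>t\<close>.\<close>

lemma t_integral_cap_le:
  assumes f: "f \<in> cont01 X"
  shows "t_integral X T cap f \<le> I f"
proof (rule cap.t_integral_le[OF f])
  fix t :: real assume t: "t \<in> {0..1}"
  let ?c = "cap {x \<in> topspace X. t \<le> f x}"
  have L: "closedin X {x \<in> topspace X. t \<le> f x}" by (intro closedin_superlevel' f)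
  have c: "?c \<in> {0..1}" by (rule cap_range[OF L])
  have less: "T s ?c \<le> I f" if s: "s \<in> {0..<t}" for s
  proof -
    let ?r = "comp_on X (ramp s t) f"
    have r: "?r \<in> cont01 X" using s by (intro cont01_mono01 f mono01_ramp) auto
    have s01: "s \<in> {0..1}" "s < t" using s t by auto
    have "?c \<le> I ?r" using s by (intro cap_le L r) (auto simp: ramp_eq_1)
    hence "T s ?c \<le> T s (I ?r)" using s01 c I_range[OF r] by (intro T_mono) auto
    also have "\<dots> \<le> I f" by (rule T_I_ramp_le[OF f s01])
    finally show ?thesis .
  qed
  show "T ?c t \<le> I f"
  \<comment> \<open>At \<open>t = 0\<close> no level \<open>s\<close> of the unit interval lies
    below \<open>t\<close>.\<close>
  proof (cases "t = 0")
    case True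
    thus ?thesis using T_zero_right[OF c] I_range[OF f] by simp
  next
    case False
    show ?thesis
    proof (rule field_le_epsilon)
      fix e :: real assume "e > 0"
      then obtain d where d: "d > 0" "\<And>s s' t. s \<in> {0..1} \<Longrightarrow> s' \<in> {0..1} \<Longrightarrow> t \<in> {0..1} \<Longrightarrow>
          \<bar>s - s'\<bar> < d \<Longrightarrow> \<bar>T s t - T s' t\<bar> < e"
        using T_uniformly_continuous by metis
      define s where "s = max 0 (t - d / 2)"
      have s: "s \<in> {0..<t}" "\<bar>t - s\<bar> < d" using d(1) t False by (auto simp: s_def)
      have "\<bar>T t ?c - T s ?c\<bar> < e" using s t by (intro d(2) c) auto
      thus "T ?c t \<le> I f + e" using less[OF s(1)] T_comm[OF c t] by simp
    qed
  qed
qed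

text \<open>The ramp from \<open>r\<close> to \<open>s\<close> vanishes unless
  \<open>f x > r\<close>, so every function admissible for the superlevel set at \<open>r\<close> is
  1 on its support. \<open>I_mono_support\<close> thus bounds the ramp by the capacity, although the
  two functions need not be functions of a common \<open>f\<close>.\<close>

lemma I_min_step:
  assumes f: "f \<in> cont01 X" and rs: "r < s" and s: "s \<in> {0..1}" and t: "t \<in> {0..1}"
  shows "I (comp_on X (\<lambda>u. min u t) f)
    \<le> max (I (comp_on X (\<lambda>u. min u s) f)) (T t (cap {x \<in> topspace X. r \<le> f x}))"
proof -
  let ?p = "\<lambda>u. min u s" and ?q = "\<lambda>u. T t (ramp r s u)"
  let ?h = "comp_on X (ramp r s) f"
  have h: "?h \<in> cont01 X" by (intro cont01_mono01 f mono01_ramp rs)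
  have p: "mono01 ?p" and q: "mono01 ?q" by (intro mono01_min mono01_T mono01_ramp rs s t)+
  have L: "closedin X {x \<in> topspace X. r \<le> f x}" by (intro closedin_superlevel' f)
  have "I (comp_on X (\<lambda>u. min u t) f) \<le> I (comp_on X (\<lambda>u. max (?p u) (?q u)) f)"
  proof (intro I_mono_comp_on f mono01_max p q mono01_min t)
    fix u :: real assume "u \<in> {0..1}"
    show "min u t \<le> max (min u s) (T t (ramp r s u))"
      using ramp_eq_1[OF rs, of u] T_one_right[OF t] by (cases "s \<le> u") auto
  qed
  also have "\<dots> = max (I (comp_on X ?p f)) (I (comp_on X ?q f))"
    using I_max[OF cont01_mono01[OF f p] cont01_mono01[OF f q] comonotone_comp_on[OF f p q]]
    by (simp add: pointwise_max_comp_on)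
  also have "I (comp_on X ?q f) = T t (I ?h)" using I_T[OF t h] by (simp add: comp_on_comp_on)
  also have "T t (I ?h) \<le> T t (cap {x \<in> topspace X. r \<le> f x})"
  proof (intro T_mono t I_range h cap_range L cap_ge order_refl)
    fix \<phi> assume \<phi>: "\<phi> \<in> cont01 X" "\<And>x. x \<in> {x \<in> topspace X. r \<le> f x} \<Longrightarrow> \<phi> x = 1"
    show "I ?h \<le> I \<phi>"
    proof (rule I_mono_support[OF h \<phi>(1)])
      fix x assume "x \<in> topspace X" "?h x \<noteq> 0"
      thus "\<phi> x = 1" using \<phi>(2)[of x] ramp_eq_0[OF rs, of "f x"] by force
    qed
  qed
  finally show ?thesis by (simp add: max.coboundedI1)
qed

text \<open>Truncations of \<open>f\<close> at the grid levels \<open>k / n\<close> are compared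
  successively. Each step takes a maximum with a term at most \<open>?J + e\<close>, so errors do
  not add up along the grid.\<close>

lemma I_le_t_integral_cap:
  assumes f: "f \<in> cont01 X"
  shows "I f \<le> t_integral X T cap f"
proof (rule field_le_epsilon)
  let ?J = "t_integral X T cap f"
  fix e :: real assume e: "e > 0"
  then obtain d where d: "d > 0" "\<And>s s' t. s \<in> {0..1} \<Longrightarrow> s' \<in> {0..1} \<Longrightarrow> t \<in> {0..1} \<Longrightarrow>
      \<bar>s - s'\<bar> < d \<Longrightarrow> \<bar>T s t - T s' t\<bar> < e"
    using T_uniformly_continuous by metis
  \<comment> \<open>The bound by \<open>e\<close> serves the first grid step; \<open>d / 2\<close>
    is needed because later steps compare levels two grid steps apart.\<close>
  obtain n :: nat where n: "n > 0" "inverse (real n) < min e (d / 2)"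
    using ex_inverse_of_nat_less[of "min e (d / 2)"] e d(1) by auto
  define \<tau> where "\<tau> k = real k / real n" for k
  have \<tau>01: "\<tau> k \<in> {0..1}" if "k \<le> n" for k using that n(1) by (auto simp: \<tau>_def)
  have \<tau>_Suc: "\<tau> (Suc k) = \<tau> k + inverse (real n)" for k
    using n(1) by (simp add: \<tau>_def field_simps)
  have J: "0 \<le> ?J"
  proof -
    have "T (cap {x \<in> topspace X. 0 \<le> f x}) 0 = 0"
      by (intro T_zero_right cap_range closedin_superlevel' f)
    thus ?thesis using cap.t_integral_ge[OF f, of 0] by simp
  qed
  have "I (comp_on X (\<lambda>u. min u (\<tau> k)) f) \<le> ?J + e" if "k \<le> n" for k
    using that
  proof (induction k)
    case 0
    have "comp_on X (\<lambda>u. min u (\<tau> 0)) f = const_on X 0"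
      using cont01_range[OF f] unfolding comp_on_def const_on_def \<tau>_def
      by (intro restrict_ext) (auto simp: min_absorb2)
    thus ?case using I_zero J e by simp
  next
    case (Suc k)
    have step: "I (comp_on X (\<lambda>u. min u (\<tau> (Suc k))) f)
      \<le> max (?J + e) (T (\<tau> (Suc k)) (cap {x \<in> topspace X. r \<le> f x}))" if "r < \<tau> k" for r
      using I_min_step[OF f that, of "\<tau> (Suc k)"] \<tau>01[of k] \<tau>01[of "Suc k"] Suc by simp
    have c: "cap {x \<in> topspace X. r \<le> f x} \<in> {0..1}" for r
      by (intro cap_range closedin_superlevel' f)
    show ?case
    proof (cases k)
      \<comment> \<open>No grid level lies below \<open>\<tau> 0\<close>, so \<open>r = -1\<close>
        is used; the new term is at most \<open>1 / n < e\<close>.\<close>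
      case 0
      have "T (\<tau> (Suc k)) (cap {x \<in> topspace X. -1 \<le> f x}) \<le> \<tau> (Suc k)"
        by (intro T_le_left \<tau>01 c Suc.prems)
      also have "\<dots> \<le> ?J + e" using n(2) J by (simp add: \<tau>_Suc 0) (simp add: \<tau>_def)
      finally show ?thesis using step[of "-1"] 0 by (simp add: \<tau>_def)
    next
      case (Suc m)
      \<comment> \<open>The capacity is taken one grid step below \<open>\<tau> k\<close>, since
        \<open>I_min_step\<close> needs \<open>r < \<tau> k\<close>. Replacing
        \<open>\<tau> (Suc k)\<close> by \<open>\<tau> m\<close> in \<open>T\<close> costs less than
        \<open>e\<close> and leaves a term of the integral.\<close>
      let ?c = "cap {x \<in> topspace X. \<tau> m \<le> f x}"
      have m: "\<tau> m \<in> {0..1}" using Suc Suc.prems by (intro \<tau>01) simp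
      have "\<bar>T (\<tau> (Suc k)) ?c - T (\<tau> m) ?c\<bar> < e"
        using n Suc by (intro d(2) \<tau>01 Suc.prems c m) (simp add: \<tau>_Suc)
      moreover have "T (\<tau> m) ?c \<le> ?J"
        using cap.t_integral_ge[OF f m] T_comm[OF c m] by simp
      moreover have "\<tau> m < \<tau> k" using Suc n(1) by (simp add: \<tau>_Suc)
      ultimately show ?thesis using step[of "\<tau> m"] by simp
    qed
  qed
  \<comment> \<open>The last grid level is 1, where truncation changes nothing.\<close>
  moreover have "comp_on X (\<lambda>u. min u (\<tau> n)) f = f"
    using f n(1) cont01_range[OF f] by (fastforce simp: comp_on_def \<tau>_def cont01_def min_def)
  ultimately show "I f \<le> ?J + e" by (metis order_refl)
qed

lemma I_eq_t_integral_cap: "f \<in> cont01 X \<Longrightarrow> I f = t_integral X T cap f"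
  by (intro antisym I_le_t_integral_cap t_integral_cap_le)

end

section \<open>The characterization\<close>

theorem theorem4:
  fixes X :: "'a topology" and T :: "real \<Rightarrow> real \<Rightarrow> real" and I :: "('a \<Rightarrow> real) \<Rightarrow> real"
  assumes "compact_space X" and "Hausdorff_space X"
    and "continuous_t_norm T"
    and "I \<in> cont01 X \<rightarrow> {0..1}"
  shows "(I (const_on X 1) = 1 \<and>
          (\<forall>\<phi>\<in>cont01 X. \<forall>\<psi>\<in>cont01 X. comonotone X \<phi> \<psi> \<longrightarrow>
              I (pointwise X max \<phi> \<psi>) = max (I \<phi>) (I \<psi>)) \<and>
          (\<forall>c\<in>{0..1}. \<forall>\<phi>\<in>cont01 X. I (pointwise X T (const_on X c) \<phi>) = T c (I \<phi>)))
     \<longleftrightarrow> (\<exists>!\<nu>. capacity X \<nu> \<and> (\<forall>f\<in>cont01 X. I f = t_integral X T \<nu> f))"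
    (is "?props \<longleftrightarrow> ?repr")
proof
  assume ?props
  then interpret maxitive_functional T X I
    using assms by unfold_locales (auto simp: pointwise_const_comp_on)
  show ?repr
  proof (rule ex1I[of _ cap])
    show "capacity X cap \<and> (\<forall>f\<in>cont01 X. I f = t_integral X T cap f)"
      using capacity_cap I_eq_t_integral_cap by blast
    show "\<mu> = cap" if "capacity X \<mu> \<and> (\<forall>f\<in>cont01 X. I f = t_integral X T \<mu> f)" for \<mu>
      using that I_eq_t_integral_cap
      by (intro capacity_eq_if_t_integral_eq[OF assms(1-3) _ capacity_cap]) auto
  qed
next
  assume ?repr
  then obtain \<nu> where \<nu>: "capacity X \<nu>" "\<And>f. f \<in> cont01 X \<Longrightarrow> I f = t_integral X T \<nu> f" by blast
  interpret compactum_capacity T X \<nu> by unfold_locales (fact assms \<nu>)+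
  \<comment> \<open>Membership is needed to replace \<open>I\<close> by the integral at the scaled
    function.\<close>
  have "comp_on X (T c) \<phi> \<in> cont01 X" if "c \<in> {0..1}" "\<phi> \<in> cont01 X" for c \<phi>
    using cont01_mono01[OF that(2) mono01_T[OF that(1) mono01_id]] .
  thus ?props
    using \<nu>(2) t_integral_one t_integral_max t_integral_T cont01_max const_on_cont01[of 1 X]
    by (simp add: pointwise_const_comp_on)
qed

end
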